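(* For primes $p\equiv5\pmod{12}$, let $g_{p^4}$ be the genus of $X_0(p^4)$ and let $V_0,V_\infty$ be the vertical $\mathbb{Q}$-divisors on the minimal regular model $\mathcal{X}_0(p^4)$ over $\mathbb{Z}$ given explicitly in the context. Then $$\frac{1}{g_{p^4}-1}\left(g_{p^4}\langle V_0,V_\infty\rangle-\frac{V_0^2+V_\infty^2}{2}\right)=4\,g_{p^4}\log(p)+o\big(g_{p^4}\log p\big)\quad\text{as }p\to\infty,$$ with $p$ running over primes $\equiv5\pmod{12}$.
   Context: For $p\equiv5\pmod{12}$ one has $g_{p^4}=1+\frac{p(p+1)(p^2-6)-6}{12}$. $\mathcal{X}_0(p^4)$ is the minimal regular model of $X_0(p^4)$ over $\mathbb{Z}$, obtained from Edixhoven's regular model (the minimal resolution of the Katz–Mazur coarse moduli scheme) by contracting three curves. Its fibre over $\mathbb{F}_p$ has components $C_{4,0}',C_{0,4}',C_{3,1}',C_{1,3}'$ (images of the reduced Katz–Mazur $(a,b)$-components $C_{a,b}$) and $E_1',E_3'$ (images of exceptional curves over $j=1728$). Their intersection matrix, in the order $C_{4,0}',C_{0,4}',C_{3,1}',C_{1,3}',E_1',E_3'$, is $$\begin{pmatrix} -A & B & D & B & 0&0\\ B & -A & B & D & 0&0\\ D & B & -G & B & 1&0\\ B & D & B & -G & 0&1\\ 0&0&1&0&-2&0\\ 0&0&0&1&0&-2 \end{pmatrix},$$ $A=\frac{2p^4-2p^3-p^2+2p-1}{24}$, $B=\frac{p^2-1}{24}$, $D=\frac{2p^3-p^2-2p+1}{24}$,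 $G=\frac{3p^2+2p+11}{24}$. For vertical divisors over $p$, the Arakelov pairing is $\langle V,W\rangle=(V\cdot W)\log p$ with $V\cdot W$ the usual intersection number, and $V^2=\langle V,V\rangle$. The divisors are $V_0=x_1C_{4,0}'+x_2C_{0,4}'+x_3C_{3,1}'+x_4C_{1,3}'+x_5E_1'+x_6E_3'$ and $V_\infty=x_1'C_{4,0}'+x_2'C_{0,4}'+x_3'C_{3,1}'+x_4'C_{1,3}'+x_5'E_1'+x_6'E_3'$ with $x_1=\frac{3p^5-p^4-16p^3-6p+12}{p^5-p^3}$, $x_2=\frac{-p^4-3p^3+10p^2+12p+6}{p^4-p^2}$, $x_3=\frac{2p^5-14p^3+12}{p^4+p^3}$, $x_4=0$, $x_5=\frac{p^5-7p^3+6}{p^4+p^3}$, $x_6=0$; $x_1'=0$, $x_2'=\frac{4p^5+2p^4-26p^3-12p^2-12p+12}{p^5-p^3}$, $x_3'=\frac{p^4+3p^3-10p^2-12p-6}{p^3+p^2}$, $x_4'=\frac{3p^5+3p^4-24p^3-12p^2-6p+12}{p^4+p^3}$, $x_5'=\frac{\frac12p^4+\frac32p^3-5p^2-6p-3}{p^3+p^2}$, $x_6'=\frac{\frac32p^5+\frac32p^4-12p^3-6p^2-3p+6}{p^4+p^3}$. (They are chosen so that, for $m\in\{0,\infty\}$, $K-(2g_{p^4}-2)H_m+V_m$ is orthogonal to all vertical divisors, where $K$ is a canonical divisor of $\mathcal{X}_0(p^4)$ and $H_0,H_\infty$ are the sections given by the cusps $0,\infty$, meeting $C_{0,4}'$ and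 $C_{4,0}'$ respectively.) *)

theory Defs
  imports "HOL-Analysis.Analysis" "HOL-Library.Landau_Symbols" "HOL-Computational_Algebra.Primes"
begin

section \<open>The genus of $X_0(N)$\<close>

definition SL2Z :: "(int^2^2) set" where
  "SL2Z = {M. det M = 1}"

definition Gamma0 :: "nat \<Rightarrow> (int^2^2) set" where
  "Gamma0 N = {M \<in> SL2Z. int N dvd M$2$1}"

definition double_cosets :: "nat \<Rightarrow> (int^2^2) set \<Rightarrow> (int^2^2) set set" where
  "double_cosets N H = {{A ** M ** B | A B. A \<in> Gamma0 N \<and> B \<in> H} | M. M \<in> SL2Z}"

text \<open>The equation is \<open>(a z + b) / (c z + d) = z\<close> with the denominator cleared (it is
  nonzero on the upper half-plane).\<close>
definition stabilizer :: "complex \<Rightarrow> (int^2^2) set" where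
  "stabilizer z = {M \<in> SL2Z.
     of_int (M$1$1) * z + of_int (M$1$2) = z * (of_int (M$2$1) * z + of_int (M$2$2))}"

definition stabilizer_infinity :: "(int^2^2) set" where
  "stabilizer_infinity = {M \<in> SL2Z. M$2$1 = 0}"

text \<open>The Euler characteristic of the compact Riemann surface $X_0(N)(\mathbb{C})$, the quotient of
  the upper half-plane with cusps by \<^term>\<open>Gamma0 N\<close>. The sphere $X(1)$ has a cell structure with
  vertices $i$ and $\rho = e^{2\pi i/3}$, one edge (the arc of the unit circle from $i$ to $\rho$)
  and one face, centred at $\infty$. The map $X_0(N) \to X(1)$ is branched at most over
  $i$, $\rho$, $\infty$, so this lifts to a cell structure on $X_0(N)$. The cells lying over a cell
  of $X(1)$ are the double cosets in $\Gamma_0(N) \backslash SL_2(\mathbb{Z}) / H$, where $H$ is the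
  stabilizer of $i$, of $\rho$, of $\infty$, and the pointwise stabilizer $\{1, -1\}$ of the edge.\<close>
definition euler_char_X0 :: "nat \<Rightarrow> int" where
  "euler_char_X0 N =
     int (card (double_cosets N (stabilizer \<i>)))
   + int (card (double_cosets N (stabilizer (cis (2 * pi / 3)))))
   - int (card (double_cosets N {mat 1, - mat 1}))
   + int (card (double_cosets N stabilizer_infinity))"

definition genus_X0 :: "nat \<Rightarrow> int" where
  "genus_X0 N = (2 - euler_char_X0 N) div 2"


section \<open>Vertical divisors over $p$ on the minimal regular model of $X_0(p^4)$\<close>

text \<open>For a prime $p \equiv 5 \pmod{12}$, the components of the fibre over $\mathbb{F}_p$:
  \<open>C40\<close>, \<open>C04\<close>, \<open>C31\<close>, \<open>C13\<close> are the images $C_{a,b}'$ of the reduced Katz--Mazur components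
  $C_{a,b}$ of Edixhoven's regular model, and \<open>E1\<close>, \<open>E3\<close> are the images $E_1'$, $E_3'$ of the
  exceptional curves over $j = 1728$ that are not contracted.\<close>
datatype component = C40 | C04 | C31 | C13 | E1 | E3

primrec index :: "component \<Rightarrow> nat" where
  "index C40 = 0"
| "index C04 = 1"
| "index C31 = 2"
| "index C13 = 3"
| "index E1 = 4"
| "index E3 = 5"

definition intersection_matrix :: "nat \<Rightarrow> rat list list" where
  "intersection_matrix p =
    (let q = rat_of_nat p;
         A = (2 * q^4 - 2 * q^3 - q^2 + 2 * q - 1) / 24;
         B = (q^2 - 1) / 24;
         D = (2 * q^3 - q^2 - 2 * q + 1) / 24;
         G = (3 * q^2 + 2 * q + 11) / 24
     in [[-A,  B,  D,  B,  0,  0],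
         [ B, -A,  B,  D,  0,  0],
         [ D,  B, -G,  B,  1,  0],
         [ B,  D,  B, -G,  0,  1],
         [ 0,  0,  1,  0, -2,  0],
         [ 0,  0,  0,  1,  0, -2]])"

text \<open>A vertical $\mathbb{Q}$-divisor over $p$ is given by its multiplicities along the components.\<close>
type_synonym vertical_divisor = "component \<Rightarrow> rat"

definition intersection_number :: "nat \<Rightarrow> vertical_divisor \<Rightarrow> vertical_divisor \<Rightarrow> rat" where
  "intersection_number p V W =
    (\<Sum>c\<in>UNIV. \<Sum>d\<in>UNIV. V c * W d * (intersection_matrix p ! index c ! index d))"

definition arakelov_pairing :: "nat \<Rightarrow> vertical_divisor \<Rightarrow> vertical_divisor \<Rightarrow> real" where
  "arakelov_pairing p V W = of_rat (intersection_number p V W) * ln (real p)"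

definition V_0 :: "nat \<Rightarrow> vertical_divisor" where
  "V_0 p = (let q = rat_of_nat p in (\<lambda>c. case c of
      C40 \<Rightarrow> (3 * q^5 - q^4 - 16 * q^3 - 6 * q + 12) / (q^5 - q^3)
    | C04 \<Rightarrow> (- (q^4) - 3 * q^3 + 10 * q^2 + 12 * q + 6) / (q^4 - q^2)
    | C31 \<Rightarrow> (2 * q^5 - 14 * q^3 + 12) / (q^4 + q^3)
    | C13 \<Rightarrow> 0
    | E1 \<Rightarrow> (q^5 - 7 * q^3 + 6) / (q^4 + q^3)
    | E3 \<Rightarrow> 0))"

definition V_infinity :: "nat \<Rightarrow> vertical_divisor" where
  "V_infinity p = (let q = rat_of_nat p in (\<lambda>c. case c of
      C40 \<Rightarrow> 0
    | C04 \<Rightarrow> (4 * q^5 + 2 * q^4 - 26 * q^3 - 12 * q^2 - 12 * q + 12) / (q^5 - q^3)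
    | C31 \<Rightarrow> (q^4 + 3 * q^3 - 10 * q^2 - 12 * q - 6) / (q^3 + q^2)
    | C13 \<Rightarrow> (3 * q^5 + 3 * q^4 - 24 * q^3 - 12 * q^2 - 6 * q + 12) / (q^4 + q^3)
    | E1 \<Rightarrow> (1/2 * q^4 + 3/2 * q^3 - 5 * q^2 - 6 * q - 3) / (q^3 + q^2)
    | E3 \<Rightarrow> (3/2 * q^5 + 3/2 * q^4 - 12 * q^3 - 6 * q^2 - 3 * q + 6) / (q^4 + q^3)))"

instance component :: finite
proof
  have "(UNIV :: component set) = {C40, C04, C31, C13, E1, E3}"
    using component.exhaust by blast
  then show "finite (UNIV :: component set)" by (metis finite.simps)
qed


definition primes_5_mod_12 :: "nat set" where
  "primes_5_mod_12 = {p. prime p \<and> p mod 12 = 5}"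

end

theory Submission
  imports Defs "HOL-Number_Theory.Cong" "HOL-Real_Asymp.Real_Asymp"
begin

text \<open>Both sides are compared with $p^4$. The theorem follows from two estimates: the genus
  satisfies $g \sim p^4/12$, and the intersection numbers satisfy
  $V_0 \cdot V_\infty \sim p^4/3$ while $V_0^2$ and $V_\infty^2$ are $O(p^4)$. Indeed, the left-hand
  side divided by $g \log p$ is
  \[ \frac{V_0 \cdot V_\infty}{g - 1} - \frac{V_0^2 + V_\infty^2}{2 g (g - 1)} - 4, \]
  where the first term tends to $(1/3)/(1/12) = 4$ and the second one to $0$, since it is $O(1/g)$.

  For the genus, let $N = p^{k+1}$. A coset $\Gamma_0(N) M$ is determined by the bottom row of $M$ as
  a point of the projective line over $\mathbb{Z}/N$, and there are $N + p^k$ such points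
  (\<open>card_right_cosets_prime_power\<close>). The double cosets of a subgroup $H$ are the orbits of $H$
  on these points. The stabilizers of $i$ and $\rho$ act through groups of order $2$ and $3$, and a
  fixed point is a root of $t^2 + 1$ or $t^2 - t + 1$ modulo $N$; there are at most two of them, so
  the numbers of orbits are one half and one third of the index up to a bounded error
  (\<open>card_double_cosets_i\<close>, \<open>card_double_cosets_rho\<close>). The unipotent translations move almost all
  points to a single one, which leaves at most $2 p^k$ cusps (\<open>card_cusps_le\<close>). The Euler
  characteristic is therefore $(1/2 + 1/3 - 1) N + O(p^k) = - N/6 + O(p^k)$.

  For the intersection numbers, the components $C_{4,0}'$ and $C_{0,4}'$ have weight $1$ and the
  four others weight $p$: the multiplicities of $V_0$ and $V_\infty$ divided by the weights
  converge, and so do the entries of the intersection matrix multiplied by both weights and divided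
  by $p^4$. What remains is the evaluation of a constant bilinear form on constant vectors.\<close>

section \<open>Integral two-by-two matrices\<close>

definition mat2 :: "int \<Rightarrow> int \<Rightarrow> int \<Rightarrow> int \<Rightarrow> int^2^2" where
  "mat2 a b c d = vector [vector [a, b], vector [c, d]]"

lemma mat2_nth [simp]:
  "mat2 a b c d $ 1 $ 1 = a" "mat2 a b c d $ 1 $ 2 = b"
  "mat2 a b c d $ 2 $ 1 = c" "mat2 a b c d $ 2 $ 2 = d"
  by (simp_all add: mat2_def)

lemma matrix2_eq_iff: "M = M' \<longleftrightarrow> M$1$1 = M'$1$1 \<and> M$1$2 = M'$1$2 \<and> M$2$1 = M'$2$1 \<and> M$2$2 = M'$2$2"
  for M M' :: "int^2^2"
  by (auto simp: vec_eq_iff forall_2)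

lemma matrix2_mult_nth [simp]:
  "(M ** M') $ i $ j = M$i$1 * M'$1$j + M$i$2 * M'$2$j" for M M' :: "int^2^2"
  by (simp add: matrix_matrix_mult_def sum_2)

lemma mat_1_nth [simp]:
  "(mat 1 :: int^2^2) $ 1 $ 1 = 1" "(mat 1 :: int^2^2) $ 1 $ 2 = 0"
  "(mat 1 :: int^2^2) $ 2 $ 1 = 0" "(mat 1 :: int^2^2) $ 2 $ 2 = 1"
  by (simp_all add: mat_def)

lemma SL2Z_iff: "M \<in> SL2Z \<longleftrightarrow> M$1$1 * M$2$2 - M$1$2 * M$2$1 = 1"
  by (simp add: SL2Z_def det_2)

lemma SL2Z_mult: "M \<in> SL2Z \<Longrightarrow> M' \<in> SL2Z \<Longrightarrow> M ** M' \<in> SL2Z"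
  by (simp add: SL2Z_def det_mul)

lemma mat_1_SL2Z: "mat 1 \<in> SL2Z"
  by (simp add: SL2Z_iff)

section \<open>Cosets of \<open>\<Gamma>\<^sub>0(N)\<close>\<close>

definition right_coset :: "nat \<Rightarrow> int^2^2 \<Rightarrow> (int^2^2) set" where
  "right_coset N M = {A ** M | A. A \<in> Gamma0 N}"

definition right_cosets :: "nat \<Rightarrow> (int^2^2) set set" where
  "right_cosets N = right_coset N ` SL2Z"

lemma mat_1_Gamma0: "mat 1 \<in> Gamma0 N"
  by (simp add: Gamma0_def mat_1_SL2Z)

lemma Gamma0_mult: "A \<in> Gamma0 N \<Longrightarrow> A' \<in> Gamma0 N \<Longrightarrow> A ** A' \<in> Gamma0 N"
  by (auto simp: Gamma0_def SL2Z_mult)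

lemma right_coset_self: "M \<in> right_coset N M"
  unfolding right_coset_def using mat_1_Gamma0 by (force simp: matrix_mul_lid)

text \<open>The determinant of the two bottom rows is, up to sign, the lower left entry of $M' M^{-1}$, so
  its divisibility by $N$ says that $M' M^{-1}$ belongs to $\Gamma_0(N)$.\<close>
lemma right_coset_mono:
  assumes M: "M \<in> SL2Z" and M': "M' \<in> SL2Z"
    and dvd: "int N dvd M$2$1 * M'$2$2 - M$2$2 * M'$2$1"
  shows "right_coset N M' \<subseteq> right_coset N M"
proof -
  define A where "A = M' ** mat2 (M$2$2) (- (M$1$2)) (- (M$2$1)) (M$1$1)"
  have "mat2 (M$2$2) (- (M$1$2)) (- (M$2$1)) (M$1$1) \<in> SL2Z"
    using M by (simp add: SL2Z_iff algebra_simps)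
  then have "A \<in> SL2Z" unfolding A_def by (rule SL2Z_mult[OF M'])
  moreover have "A$2$1 = - (M$2$1 * M'$2$2 - M$2$2 * M'$2$1)"
    by (simp add: A_def)
  ultimately have A: "A \<in> Gamma0 N" using dvd unfolding Gamma0_def
    by (metis (mono_tags, lifting) dvd_minus_iff mem_Collect_eq)
  have "mat2 (M$2$2) (- (M$1$2)) (- (M$2$1)) (M$1$1) ** M = mat 1"
    using M unfolding matrix2_eq_iff by (simp add: SL2Z_iff algebra_simps)
  then have "M' = A ** M"
    by (simp add: A_def matrix_mul_assoc[symmetric])
  then show ?thesis using A
    unfolding right_coset_def by (auto simp: matrix_mul_assoc intro: Gamma0_mult)
qed

text \<open>This identifies $\Gamma_0(N) \backslash SL_2(\mathbb{Z})$ with the bottom rows viewed as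
  points of the projective line over $\mathbb{Z}/N$; all later counting goes through it.\<close>
lemma right_coset_eq_iff:
  assumes M: "M \<in> SL2Z" and M': "M' \<in> SL2Z"
  shows "right_coset N M = right_coset N M' \<longleftrightarrow> int N dvd M$2$1 * M'$2$2 - M$2$2 * M'$2$1"
proof
  assume "right_coset N M = right_coset N M'"
  then obtain A where A: "A \<in> Gamma0 N" "M' = A ** M"
    using right_coset_self[of M' N] by (auto simp: right_coset_def)
  have "M$2$1 * M'$2$2 - M$2$2 * M'$2$1 = - (A$2$1) * (M$1$1 * M$2$2 - M$1$2 * M$2$1)"
    using A(2) by (simp add: algebra_simps)
  also have "\<dots> = - (A$2$1)" using M by (simp add: SL2Z_iff)
  finally show "int N dvd M$2$1 * M'$2$2 - M$2$2 * M'$2$1"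
    using A(1) by (simp add: Gamma0_def)
next
  assume dvd: "int N dvd M$2$1 * M'$2$2 - M$2$2 * M'$2$1"
  then have "int N dvd - (M$2$1 * M'$2$2 - M$2$2 * M'$2$1)" by (simp only: dvd_minus_iff)
  then have "int N dvd M'$2$1 * M$2$2 - M'$2$2 * M$2$1" by (simp add: algebra_simps)
  with dvd show "right_coset N M = right_coset N M'"
    using right_coset_mono[OF M M'] right_coset_mono[OF M' M] by blast
qed

lemma right_coset_mult_Gamma0:
  assumes "A \<in> Gamma0 N" "M \<in> SL2Z"
  shows "right_coset N (A ** M) = right_coset N M"
proof -
  have A: "A \<in> SL2Z" "int N dvd A$2$1" using assms by (auto simp: Gamma0_def)
  have "(A ** M)$2$1 * M$2$2 - (A ** M)$2$2 * M$2$1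
      = A$2$1 * (M$1$1 * M$2$2 - M$1$2 * M$2$1)"
    by (simp add: algebra_simps)
  then show ?thesis
    using A right_coset_eq_iff[OF SL2Z_mult[OF A(1) assms(2)] assms(2)] by simp
qed

lemma right_coset_uminus:
  assumes "M \<in> SL2Z"
  shows "right_coset N (- M) = right_coset N M"
  using assms by (subst right_coset_eq_iff) (auto simp: SL2Z_iff)

lemma right_coset_mult_cong:
  assumes "right_coset N M = right_coset N M'"
  shows "right_coset N (M ** h) = right_coset N (M' ** h)"
proof -
  have *: "right_coset N (X ** h) = (\<lambda>Y. Y ** h) ` right_coset N X" for X
    by (auto simp: right_coset_def matrix_mul_assoc image_iff)
  show ?thesis by (simp only: * assms)
qed

text \<open>The double coset that contains a given coset of $\Gamma_0(N)$.\<close>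
definition saturate :: "(int^2^2) set \<Rightarrow> (int^2^2) set \<Rightarrow> (int^2^2) set" where
  "saturate H C = {M ** B | M B. M \<in> C \<and> B \<in> H}"

text \<open>Counting double cosets becomes counting the values of a function on the finite set of
  cosets of $\Gamma_0(N)$, so that the sizes of its fibres can be used.\<close>
lemma double_cosets_eq_saturate: "double_cosets N H = saturate H ` right_cosets N"
proof -
  have *: "saturate H (right_coset N M) = {A ** M ** B | A B. A \<in> Gamma0 N \<and> B \<in> H}" for M
    by (auto simp: saturate_def right_coset_def)
  show ?thesis
    by (simp only: double_cosets_def right_cosets_def image_image * Setcompr_eq_image)
qed

definition matrix_subgroup :: "(int^2^2) set \<Rightarrow> bool" where
  "matrix_subgroup H \<longleftrightarrow> H \<subseteq> SL2Z \<and> mat 1 \<in> H \<and> (\<forall>B\<in>H. \<forall>B'\<in>H. B ** B' \<in> H) \<and>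
     (\<forall>B\<in>H. \<exists>B'\<in>H. B ** B' = mat 1)"

lemma saturate_mult:
  assumes H: "matrix_subgroup H" and h: "h \<in> H"
  shows "saturate H (right_coset N (M ** h)) = saturate H (right_coset N M)"
proof -
  obtain h' where h': "h' \<in> H" "h ** h' = mat 1"
    using H h by (auto simp: matrix_subgroup_def)
  have cl: "\<And>B B'. B \<in> H \<Longrightarrow> B' \<in> H \<Longrightarrow> B ** B' \<in> H"
    using H by (auto simp: matrix_subgroup_def)
  have "\<exists>B'\<in>H. A ** M ** B = A ** (M ** h) ** B'" if "B \<in> H" for A B
  proof
    show "h' ** B \<in> H" using cl h' that by blast
    have "A ** (M ** h) ** (h' ** B) = A ** M ** ((h ** h') ** B)"
      by (simp only: matrix_mul_assoc)
    then show "A ** M ** B = A ** (M ** h) ** (h' ** B)"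
      by (simp add: h')
  qed
  moreover have "\<exists>B'\<in>H. A ** (M ** h) ** B = A ** M ** B'" if "B \<in> H" for A B
    using cl[OF h that] by (metis matrix_mul_assoc)
  ultimately show ?thesis
    by (fastforce simp: saturate_def right_coset_def)
qed

text \<open>The fibres are the orbits of \<open>H\<close> under multiplication from the right.\<close>
lemma saturate_fibre:
  assumes H: "matrix_subgroup H" and M: "M \<in> SL2Z"
  shows "{C \<in> right_cosets N. saturate H C = saturate H (right_coset N M)}
       = (\<lambda>h. right_coset N (M ** h)) ` H"
proof (intro equalityI subsetI)
  fix C assume "C \<in> {C \<in> right_cosets N. saturate H C = saturate H (right_coset N M)}"
  then obtain M' where M': "M' \<in> SL2Z" "C = right_coset N M'"
    and eq: "saturate H (right_coset N M') = saturate H (right_coset N M)"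
    by (auto simp: right_cosets_def)
  have "M' ** mat 1 \<in> saturate H (right_coset N M')"
    using right_coset_self H unfolding saturate_def matrix_subgroup_def by blast
  then obtain A h where Ah: "A \<in> Gamma0 N" "h \<in> H" "M' = A ** M ** h"
    unfolding eq by (auto simp: saturate_def right_coset_def)
  have "M ** h \<in> SL2Z" using H Ah M by (auto simp: matrix_subgroup_def intro: SL2Z_mult)
  then have "C = right_coset N (M ** h)"
    using right_coset_mult_Gamma0[OF Ah(1), of "M ** h"] Ah(3) M'(2) by (simp add: matrix_mul_assoc)
  then show "C \<in> (\<lambda>h. right_coset N (M ** h)) ` H" using Ah by blast
next
  fix C assume "C \<in> (\<lambda>h. right_coset N (M ** h)) ` H"
  then obtain h where h: "h \<in> H" "C = right_coset N (M ** h)" by blast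
  have "M ** h \<in> SL2Z" using H h M by (auto simp: matrix_subgroup_def intro: SL2Z_mult)
  then show "C \<in> {C \<in> right_cosets N. saturate H C = saturate H (right_coset N M)}"
    using h saturate_mult[OF H h(1)] by (auto simp: right_cosets_def)
qed

lemma matrix_subgroup_pm1: "matrix_subgroup {mat 1, - mat 1}"
  unfolding matrix_subgroup_def by (simp add: matrix2_eq_iff SL2Z_iff)

text \<open>Since $-1$ belongs to $\Gamma_0(N)$, every orbit of $\{1, -1\}$ is a single coset. Hence the number
  of edges in the cell structure is the index of $\Gamma_0(N)$.\<close>
lemma card_double_cosets_pm1: "card (double_cosets N {mat 1, - mat 1}) = card (right_cosets N)"
proof -
  have "inj_on (saturate {mat 1, - mat 1}) (right_cosets N)"
  proof (rule inj_onI)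
    fix C C' assume C: "C \<in> right_cosets N" and C': "C' \<in> right_cosets N"
      and eq: "saturate {mat 1, - mat 1} C = saturate {mat 1, - mat 1} C'"
    obtain M where M: "M \<in> SL2Z" "C' = right_coset N M" using C' by (auto simp: right_cosets_def)
    have "M ** - mat 1 = - M" by (simp add: matrix2_eq_iff)
    then show "C = C'"
      using saturate_fibre[OF matrix_subgroup_pm1 M(1), of N] C eq M right_coset_uminus[OF M(1), of N]
      by (auto simp: matrix_mul_rid)
  qed
  then show ?thesis by (simp add: double_cosets_eq_saturate card_image)
qed

section \<open>The index of \<open>\<Gamma>\<^sub>0(p\<^sup>r)\<close>\<close>

text \<open>Matrices whose bottom rows are the points $(t : 1)$ and $(1 : u)$ of the projective line.\<close>
definition finite_point :: "int \<Rightarrow> int^2^2" where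
  "finite_point t = mat2 1 0 t 1"

definition infinite_point :: "int \<Rightarrow> int^2^2" where
  "infinite_point u = mat2 0 (-1) 1 u"

lemma points_SL2Z: "finite_point t \<in> SL2Z" "infinite_point u \<in> SL2Z"
  by (simp_all add: finite_point_def infinite_point_def SL2Z_iff)

lemma cong_int_inverse:
  assumes "prime p" "\<not> int p dvd d"
  obtains e where "int (p ^ k) dvd d * e - 1"
proof -
  have "coprime (int p) d" using assms by (simp add: prime_imp_coprime)
  then have "coprime d (int (p ^ k))" by (simp add: coprime_commute)
  then obtain e where "[d * e = 1] (mod int (p ^ k))" using cong_solve_coprime_int by blast
  then show ?thesis using that by (simp add: cong_iff_dvd_diff)
qed

text \<open>If $p$ does not divide the second entry of the bottom row, that entry is a unit modulo $p^k$ and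
  can be scaled to $1$.\<close>
lemma right_coset_finite_point:
  assumes p: "prime p" and M: "M \<in> SL2Z" and d: "\<not> int p dvd M$2$2"
  shows "\<exists>t\<in>{0..<int (p ^ k)}. right_coset (p ^ k) M = right_coset (p ^ k) (finite_point t)"
proof -
  let ?N = "int (p ^ k)"
  obtain e where e: "?N dvd M$2$2 * e - 1" using cong_int_inverse[OF p d] by blast
  define t where "t = (M$2$1 * e) mod ?N"
  have pos: "?N > 0" using p by (simp add: prime_gt_0_nat)
  then have "t \<in> {0..<?N}" by (simp add: t_def)
  moreover have "?N dvd M$2$1 * 1 - M$2$2 * t"
  proof -
    have *: "?N dvd M$2$1 * e - t" unfolding t_def by (rule dvd_minus_mod)
    have "?N dvd M$2$2 * (M$2$1 * e - t) - M$2$1 * (M$2$2 * e - 1)"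
      by (rule dvd_diff[OF dvd_mult[OF *] dvd_mult[OF e]])
    then show ?thesis by (simp add: algebra_simps)
  qed
  ultimately show ?thesis
    using right_coset_eq_iff[OF M points_SL2Z(1)] by (auto simp: finite_point_def)
qed

lemma SL2Z_row_not_dvd:
  assumes p: "prime p" and M: "M \<in> SL2Z" and d: "int p dvd M$2$2"
  shows "\<not> int p dvd M$2$1"
proof
  assume "int p dvd M$2$1"
  then have "int p dvd M$1$1 * M$2$2 - M$1$2 * M$2$1" using d by (intro dvd_diff dvd_mult)
  then have "int p dvd 1" using M by (simp add: SL2Z_iff)
  then show False using p by (metis int_dvd_int_iff not_prime_unit of_nat_1)
qed

text \<open>Otherwise the first entry is a unit, as the row is primitive; scaling it to $1$ leaves a second
  entry divisible by $p$, which has only $p^k$ values modulo $p^{k+1}$.\<close>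
lemma right_coset_infinite_point:
  assumes p: "prime p" and M: "M \<in> SL2Z" and d: "int p dvd M$2$2"
  shows "\<exists>u\<in>{0..<int (p ^ k)}. right_coset (p ^ Suc k) M = right_coset (p ^ Suc k) (infinite_point (int p * u))"
proof -
  let ?N = "int (p ^ Suc k)"
  obtain e where e: "?N dvd M$2$1 * e - 1"
    using cong_int_inverse[OF p SL2Z_row_not_dvd[OF p M d]] by blast
  obtain d' where d': "M$2$2 = int p * d'" using d by blast
  define u where "u = (d' * e) mod int (p ^ k)"
  have pos: "int (p ^ k) > 0" using p by (simp add: prime_gt_0_nat)
  then have "u \<in> {0..<int (p ^ k)}" by (simp add: u_def)
  moreover have "?N dvd M$2$1 * (int p * u) - M$2$2 * 1"
  proof -
    have "int (p ^ k) dvd d' * e - u" unfolding u_def by (rule dvd_minus_mod)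
    then have *: "?N dvd int p * (d' * e - u)" by (simp add: mult_dvd_mono)
    have "?N dvd M$2$2 * (M$2$1 * e - 1) - M$2$1 * (int p * (d' * e - u))"
      by (rule dvd_diff[OF dvd_mult[OF e] dvd_mult[OF *]])
    then show ?thesis by (simp add: algebra_simps d')
  qed
  ultimately show ?thesis
    using right_coset_eq_iff[OF M points_SL2Z(2)] by (auto simp: infinite_point_def)
qed

lemma eq_of_dvd_diff:
  fixes t s n :: int
  assumes "n dvd t - s" "t \<in> {0..<n}" "s \<in> {0..<n}"
  shows "t = s"
  using assms by (metis atLeastLessThan_iff mod_eq_dvd_iff mod_pos_pos_trivial)

lemma right_cosets_prime_power:
  assumes p: "prime p"
  shows "right_cosets (p ^ Suc k) =
    (\<lambda>t. right_coset (p ^ Suc k) (finite_point t)) ` {0..<int (p ^ Suc k)} \<union>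
    (\<lambda>u. right_coset (p ^ Suc k) (infinite_point (int p * u))) ` {0..<int (p ^ k)}"
    (is "_ = ?F \<union> ?I")
proof (intro equalityI subsetI)
  fix C assume "C \<in> right_cosets (p ^ Suc k)"
  then obtain M where M: "M \<in> SL2Z" "C = right_coset (p ^ Suc k) M"
    by (auto simp: right_cosets_def)
  then show "C \<in> ?F \<union> ?I"
    using right_coset_finite_point[OF p M(1), of "Suc k"] right_coset_infinite_point[OF p M(1), of k]
    by (cases "int p dvd M$2$2") (auto simp del: power_Suc)
next
  fix C assume "C \<in> ?F \<union> ?I"
  then show "C \<in> right_cosets (p ^ Suc k)"
    using points_SL2Z by (auto simp: right_cosets_def)
qed

lemma card_right_cosets_prime_power:
  assumes p: "prime p"
  shows "card (right_cosets (p ^ Suc k)) = p ^ Suc k + p ^ k"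
proof -
  let ?N = "p ^ Suc k"
  let ?f = "\<lambda>t. right_coset ?N (finite_point t)"
  let ?i = "\<lambda>u. right_coset ?N (infinite_point (int p * u))"
  have p0: "p > 0" using p by (rule prime_gt_0_nat)
  have "inj_on ?f {0..<int ?N}"
  proof (rule inj_onI)
    fix t s assume ts: "t \<in> {0..<int ?N}" "s \<in> {0..<int ?N}" and "?f t = ?f s"
    then have "int ?N dvd t - s"
      using right_coset_eq_iff[OF points_SL2Z(1) points_SL2Z(1)] by (simp add: finite_point_def)
    then show "t = s" using eq_of_dvd_diff ts by blast
  qed
  moreover have "inj_on ?i {0..<int (p ^ k)}"
  proof (rule inj_onI)
    fix t s assume ts: "t \<in> {0..<int (p ^ k)}" "s \<in> {0..<int (p ^ k)}" and "?i t = ?i s"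
    then have "int ?N dvd int p * s - int p * t"
      using right_coset_eq_iff[OF points_SL2Z(2) points_SL2Z(2)] by (simp add: infinite_point_def)
    then have "int p * int (p ^ k) dvd int p * (s - t)" by (simp add: algebra_simps)
    then have "int (p ^ k) dvd s - t" using p0 by simp
    then show "t = s" using eq_of_dvd_diff ts by blast
  qed
  moreover have "?f ` {0..<int ?N} \<inter> ?i ` {0..<int (p ^ k)} = {}"
  proof -
    have "?f t \<noteq> ?i u" for t u
    proof
      assume "?f t = ?i u"
      then have "int ?N dvd t * (int p * u) - 1"
        using right_coset_eq_iff[OF points_SL2Z(1) points_SL2Z(2)]
        by (simp add: infinite_point_def finite_point_def)
      then have "int p dvd t * (int p * u) - 1" by (auto intro: dvd_mult_left)
      then have "int p dvd t * (int p * u) - (t * (int p * u) - 1)"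
        by (rule dvd_diff[rotated]) simp
      then have "int p dvd 1" by (simp only: diff_diff_eq2 add_diff_cancel_left')
      then show False using p not_prime_1 by auto
    qed
    then show ?thesis by blast
  qed
  ultimately show ?thesis
    unfolding right_cosets_prime_power[OF p]
    by (subst card_Un_disjoint) (simp_all add: card_image del: of_nat_power power_Suc)
qed

section \<open>Elliptic points\<close>

text \<open>An orbit count: if all fibres have at most $k$ elements, and exactly $k$ except those that meet
  the exceptional set \<open>E\<close>, then the number of fibres is $|X|/k$ with an error of at most $|E|$.\<close>
lemma card_image_fibres:
  assumes fin: "finite X" and EX: "E \<subseteq> X"
    and le: "\<And>x. x \<in> X \<Longrightarrow> card {y \<in> X. f y = f x} \<le> k"
    and eq: "\<And>x. x \<in> X - E \<Longrightarrow> card {y \<in> X. f y = f x} = k"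
  shows "card X \<le> k * card (f ` X)" and "k * card (f ` X) \<le> card X + k * card E"
proof -
  have sum: "card X = (\<Sum>z\<in>f ` X. card {y \<in> X. f y = z})"
    using sum.image_gen[OF fin, of "\<lambda>_. 1::nat" f] by simp
  also have "\<dots> \<le> (\<Sum>z\<in>f ` X. k)" using le by (intro sum_mono) auto
  finally show "card X \<le> k * card (f ` X)" by (simp add: mult.commute)
  have "k * card (f ` (X - E)) = (\<Sum>z\<in>f ` (X - E). card {y \<in> X. f y = z})"
    using eq by (subst sum.cong[of _ _ _ "\<lambda>_. k"]) auto
  also have "\<dots> \<le> card X" unfolding sum using fin by (intro sum_mono2) auto
  finally have 1: "k * card (f ` (X - E)) \<le> card X" .
  have "f ` X = f ` (X - E) \<union> f ` E" using EX by auto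
  then have "card (f ` X) \<le> card (f ` (X - E)) + card (f ` E)" by (simp add: card_Un_le)
  also have "card (f ` E) \<le> card E" using fin EX finite_subset by (blast intro: card_image_le)
  finally have "k * card (f ` X) \<le> k * card (f ` (X - E)) + k * card E"
    by (simp add: distrib_left[symmetric])
  with 1 show "k * card (f ` X) \<le> card X + k * card E" by linarith
qed

text \<open>The matrix with determinant $1$ and trace \<open>s\<close> in companion form. Modulo sign it generates the
  stabilizer of $i$ for \<open>s = 0\<close> and that of $\rho$ for \<open>s = 1\<close>, which lets both cases
  share their proofs.\<close>
definition elliptic :: "int \<Rightarrow> int^2^2" where
  "elliptic s = mat2 0 (-1) 1 s"

lemma elliptic_SL2Z: "elliptic s \<in> SL2Z"
  by (simp add: elliptic_def SL2Z_iff)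

definition fixed_cosets :: "nat \<Rightarrow> int \<Rightarrow> (int^2^2) set set" where
  "fixed_cosets N s = {right_coset N M | M. M \<in> SL2Z \<and> right_coset N (M ** elliptic s) = right_coset N M}"

lemma fixed_coset_iff:
  assumes "M \<in> SL2Z"
  shows "right_coset N (M ** elliptic s) = right_coset N M
     \<longleftrightarrow> int N dvd (M$2$1)\<^sup>2 - s * M$2$1 * M$2$2 + (M$2$2)\<^sup>2"
  unfolding right_coset_eq_iff[OF SL2Z_mult[OF assms elliptic_SL2Z] assms]
  by (simp add: elliptic_def algebra_simps power2_eq_square)

text \<open>Two roots $t, t_0$ satisfy $p^k \mid (t - t_0)(t + t_0 - s)$. If $p$ divided both factors it would
  divide $2 t_0 - s$, and $(2 t_0 - s)^2 = s^2 - 4 + 4 (t_0^2 - s t_0 + 1)$, hence the discriminant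
  $s^2 - 4$. So $p^k$ divides one of the factors, and $t$ is congruent to $t_0$ or to $s - t_0$.\<close>
lemma card_quadratic_roots:
  assumes p: "prime p" and disc: "\<not> int p dvd s\<^sup>2 - 4"
  shows "card {t \<in> {0..<int (p ^ k)}. int (p ^ k) dvd t\<^sup>2 - s * t + 1} \<le> 2" (is "card ?R \<le> 2")
proof (cases "k = 0 \<or> ?R = {}")
  case True
  then have "?R \<subseteq> {0}" by auto
  then have "card ?R \<le> card {0::int}" by (intro card_mono) auto
  then show ?thesis by simp
next
  case False
  let ?N = "int (p ^ k)"
  obtain t0 where t0: "t0 \<in> {0..<?N}" "?N dvd t0\<^sup>2 - s * t0 + 1" using False by blast
  have "int p dvd ?N" using False by (simp add: dvd_power)
  then have p0: "int p dvd t0\<^sup>2 - s * t0 + 1" using t0 dvd_trans by blast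
  have "?R \<subseteq> {t0, (s - t0) mod ?N}"
  proof
    fix t assume "t \<in> ?R"
    then have t: "t \<in> {0..<?N}" "?N dvd t\<^sup>2 - s * t + 1" by auto
    have "?N dvd (t\<^sup>2 - s * t + 1) - (t0\<^sup>2 - s * t0 + 1)" using t t0 by (intro dvd_diff)
    then have prod: "?N dvd (t - t0) * (t + t0 - s)"
      by (simp add: algebra_simps power2_eq_square)
    have "\<not> (int p dvd t - t0 \<and> int p dvd t + t0 - s)"
    proof
      assume "int p dvd t - t0 \<and> int p dvd t + t0 - s"
      then have "int p dvd (t + t0 - s) - (t - t0)" by (blast intro: dvd_diff)
      then have *: "int p dvd 2 * t0 - s" by (simp add: algebra_simps)
      have "int p dvd (2 * t0 - s) * (2 * t0 - s) - 4 * (t0\<^sup>2 - s * t0 + 1)"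
        by (rule dvd_diff[OF dvd_mult[OF *] dvd_mult[OF p0]])
      then have "int p dvd s\<^sup>2 - 4" by (simp add: algebra_simps power2_eq_square)
      with disc show False ..
    qed
    then consider "coprime ?N (t - t0)" | "coprime ?N (t + t0 - s)"
      using p by (auto simp: prime_imp_coprime)
    then show "t \<in> {t0, (s - t0) mod ?N}"
    proof cases
      case 1
      then have "?N dvd t + t0 - s" using prod by (simp add: coprime_dvd_mult_right_iff)
      then have "t mod ?N = (s - t0) mod ?N" by (simp add: mod_eq_dvd_iff algebra_simps)
      then show ?thesis using t by simp
    next
      case 2
      then have "?N dvd t - t0" using prod by (simp add: coprime_dvd_mult_left_iff)
      then show ?thesis using eq_of_dvd_diff t t0 by blast
    qed
  qed
  then have "card ?R \<le> card {t0, (s - t0) mod ?N}" by (intro card_mono) auto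
  also have "\<dots> \<le> 2" by (simp add: card_insert_if)
  finally show ?thesis .
qed

text \<open>A fixed coset has a bottom row $(c, d)$ with $c^2 - s c d + d^2 \equiv 0$. Were $p$ to divide $d$
  it would also divide $c$, so the row can be scaled to $(t, 1)$ with $t$ a root of
  $t^2 - s t + 1$.\<close>
lemma card_fixed_cosets:
  assumes p: "prime p" and disc: "\<not> int p dvd s\<^sup>2 - 4"
  shows "card (fixed_cosets (p ^ Suc k) s) \<le> 2"
proof -
  let ?N = "p ^ Suc k"
  let ?R = "{t \<in> {0..<int ?N}. int ?N dvd t\<^sup>2 - s * t + 1}"
  have "fixed_cosets ?N s \<subseteq> (\<lambda>t. right_coset ?N (finite_point t)) ` ?R"
  proof
    fix C assume "C \<in> fixed_cosets ?N s"
    then obtain M where M: "M \<in> SL2Z" and C: "C = right_coset ?N M"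
      and fixM: "right_coset ?N (M ** elliptic s) = right_coset ?N M"
      by (auto simp: fixed_cosets_def)
    have "\<not> int p dvd M$2$2"
    proof
      assume d: "int p dvd M$2$2"
      have "int ?N dvd (M$2$1)\<^sup>2 - s * M$2$1 * M$2$2 + (M$2$2)\<^sup>2"
        using fixM M by (simp only: fixed_coset_iff)
      then have "int p dvd (M$2$1)\<^sup>2 - s * M$2$1 * M$2$2 + (M$2$2)\<^sup>2"
        by (auto intro: dvd_mult_left)
      then have "int p dvd ((M$2$1)\<^sup>2 - s * M$2$1 * M$2$2 + (M$2$2)\<^sup>2) - M$2$2 * (M$2$2 - s * M$2$1)"
        using d by (intro dvd_diff dvd_mult2)
      then have "int p dvd (M$2$1)\<^sup>2" by (simp add: algebra_simps power2_eq_square)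
      then show False using SL2Z_row_not_dvd[OF p M d] p
        by (simp add: prime_dvd_power_iff)
    qed
    then obtain t where t: "t \<in> {0..<int ?N}" "C = right_coset ?N (finite_point t)"
      using right_coset_finite_point[OF p M] C by blast
    have "right_coset ?N (finite_point t ** elliptic s) = right_coset ?N (finite_point t)"
      using right_coset_mult_cong[of ?N M "finite_point t" "elliptic s"] C t fixM by simp
    then have "int ?N dvd t\<^sup>2 - s * t + 1"
      unfolding fixed_coset_iff[OF points_SL2Z(1)] by (simp add: finite_point_def)
    with t show "C \<in> (\<lambda>t. right_coset ?N (finite_point t)) ` ?R" by blast
  qed
  moreover have "finite ?R" by (rule finite_subset[of _ "{0..<int ?N}"]) auto
  ultimately have "card (fixed_cosets ?N s) \<le> card ?R" by (intro surj_card_le)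
  also have "\<dots> \<le> 2" using card_quadratic_roots[OF p disc] .
  finally show ?thesis .
qed

text \<open>As $1$ and $z$ are linearly independent over $\mathbb{Q}$, comparing coefficients in
  $a z + b = c z^2 + d z$ expresses $a$ and $b$ by $c$ and $d$. The stabilizer thus consists of the
  elements of norm $1$ in the quadratic order $\mathbb{Z}[z]$.\<close>
lemma stabilizer_quadratic:
  assumes Im: "Im z \<noteq> 0" and z: "z\<^sup>2 = - of_int s * z - 1"
  shows "stabilizer z = {mat2 (d - c * s) (- c) c d | c d. c\<^sup>2 - s * c * d + d\<^sup>2 = 1}"
proof -
  have key: "of_int (M$1$1) * z + of_int (M$1$2) = z * (of_int (M$2$1) * z + of_int (M$2$2))
     \<longleftrightarrow> M$1$1 = M$2$2 - M$2$1 * s \<and> M$1$2 = - M$2$1" for M :: "int^2^2"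
  proof -
    have "z * (of_int (M$2$1) * z + of_int (M$2$2)) = of_int (M$2$1) * z\<^sup>2 + of_int (M$2$2) * z"
      by (simp add: algebra_simps power2_eq_square)
    also have "\<dots> = of_int (M$2$2 - M$2$1 * s) * z + of_int (- M$2$1)"
      unfolding z by (simp add: algebra_simps)
    finally have e: "z * (of_int (M$2$1) * z + of_int (M$2$2))
       = of_int (M$2$2 - M$2$1 * s) * z + of_int (- M$2$1)" .
    have ind: "of_int a * z + of_int b = of_int a' * z + of_int b' \<longleftrightarrow> a = a' \<and> b = b'" for a b a' b'
    proof
      assume h: "of_int a * z + of_int b = of_int a' * z + of_int b'"
      have "of_int a * Im z = of_int a' * Im z" using arg_cong[OF h, of Im] by simp
      then have "a = a'" using Im by simp
      then show "a = a' \<and> b = b'" using h by simp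
    qed simp
    show ?thesis unfolding e ind ..
  qed
  show ?thesis
  proof (intro equalityI subsetI)
    fix M assume "M \<in> stabilizer z"
    then have *: "M$1$1 * M$2$2 - M$1$2 * M$2$1 = 1 \<and> M$1$1 = M$2$2 - M$2$1 * s \<and> M$1$2 = - M$2$1"
      unfolding stabilizer_def mem_Collect_eq key SL2Z_iff .
    then have det: "M$1$1 * M$2$2 - M$1$2 * M$2$1 = 1" by (rule conjunct1)
    from * have M: "M$1$1 = M$2$2 - M$2$1 * s" "M$1$2 = - M$2$1" by (blast+)
    have "(M$2$1)\<^sup>2 - s * M$2$1 * M$2$2 + (M$2$2)\<^sup>2 = 1"
      using det unfolding M by (simp add: algebra_simps power2_eq_square)
    moreover have "M = mat2 (M$2$2 - M$2$1 * s) (- M$2$1) (M$2$1) (M$2$2)"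
      using M by (simp add: matrix2_eq_iff)
    ultimately show "M \<in> {mat2 (d - c * s) (- c) c d | c d. c\<^sup>2 - s * c * d + d\<^sup>2 = 1}" by blast
  next
    fix M assume "M \<in> {mat2 (d - c * s) (- c) c d | c d. c\<^sup>2 - s * c * d + d\<^sup>2 = 1}"
    then obtain c d where M: "M = mat2 (d - c * s) (- c) c d" and cd: "c\<^sup>2 - s * c * d + d\<^sup>2 = 1"
      by blast
    from cd show "M \<in> stabilizer z"
      unfolding stabilizer_def mem_Collect_eq key SL2Z_iff M
      by (simp add: algebra_simps power2_eq_square)
  qed
qed

text \<open>This is the multiplicativity of the norm form $c^2 - s c d + d^2$.\<close>
lemma matrix_subgroup_quadratic:
  "matrix_subgroup {mat2 (d - c * s) (- c) c d | c d. c\<^sup>2 - s * c * d + d\<^sup>2 = 1}" (is "matrix_subgroup ?H")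
  unfolding matrix_subgroup_def
proof (intro conjI ballI)
  show "?H \<subseteq> SL2Z" by (auto simp: SL2Z_iff algebra_simps power2_eq_square)
  show "mat 1 \<in> ?H" by (auto simp: matrix2_eq_iff)
next
  fix B B' assume "B \<in> ?H" "B' \<in> ?H"
  then obtain c d c' d' where B: "B = mat2 (d - c * s) (- c) c d" "c\<^sup>2 - s * c * d + d\<^sup>2 = 1"
    "B' = mat2 (d' - c' * s) (- c') c' d'" "c'\<^sup>2 - s * c' * d' + d'\<^sup>2 = 1" by blast
  define c'' d'' where "c'' = c * d' + d * c' - s * c * c'" and "d'' = d * d' - c * c'"
  have "c''\<^sup>2 - s * c'' * d'' + d''\<^sup>2 = (c\<^sup>2 - s * c * d + d\<^sup>2) * (c'\<^sup>2 - s * c' * d' + d'\<^sup>2)"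
    by (simp add: c''_def d''_def algebra_simps power2_eq_square)
  moreover have "B ** B' = mat2 (d'' - c'' * s) (- c'') c'' d''"
    unfolding matrix2_eq_iff B c''_def d''_def by (simp add: algebra_simps)
  ultimately show "B ** B' \<in> ?H" using B by auto
next
  fix B assume "B \<in> ?H"
  then obtain c d where B: "B = mat2 (d - c * s) (- c) c d" "c\<^sup>2 - s * c * d + d\<^sup>2 = 1" by blast
  define d' where "d' = d - c * s"
  have "(- c)\<^sup>2 - s * (- c) * d' + d'\<^sup>2 = 1"
    using B(2) by (simp add: d'_def algebra_simps power2_eq_square)
  moreover have "B ** mat2 (d' - (- c) * s) (- (- c)) (- c) d' = mat 1"
    unfolding matrix2_eq_iff B d'_def using B(2) by (simp add: algebra_simps power2_eq_square)
  ultimately show "\<exists>B'\<in>?H. B ** B' = mat 1" by blast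
qed

lemma square_le_1_int: "x\<^sup>2 \<le> 1 \<Longrightarrow> x \<in> {-1, 0, 1}" for x :: int
proof -
  assume "x\<^sup>2 \<le> 1"
  then have "\<bar>x\<bar> \<le> 1" by (simp add: abs_square_le_1)
  then show ?thesis by auto
qed

lemma stabilizer_i:
  "matrix_subgroup (stabilizer \<i>)"
  "stabilizer \<i> = {mat 1, - mat 1, elliptic 0, - elliptic 0}"
proof -
  have eq: "stabilizer \<i> = {mat2 (d - c * 0) (- c) c d | c d. c\<^sup>2 - 0 * c * d + d\<^sup>2 = 1}"
    by (rule stabilizer_quadratic) auto
  show "matrix_subgroup (stabilizer \<i>)" unfolding eq by (rule matrix_subgroup_quadratic)
  have "(c = 1 \<and> d = 0) \<or> (c = -1 \<and> d = 0) \<or> (c = 0 \<and> d = 1) \<or> (c = 0 \<and> d = -1)"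
    if "c\<^sup>2 + d\<^sup>2 = 1" for c d :: int
  proof -
    have "c\<^sup>2 \<le> 1" "d\<^sup>2 \<le> 1" using that zero_le_power2[of c] zero_le_power2[of d] by linarith+
    then show ?thesis using that square_le_1_int[of c] square_le_1_int[of d] by auto
  qed
  then have sol: "c\<^sup>2 + d\<^sup>2 = 1 \<longleftrightarrow> (c = 1 \<and> d = 0) \<or> (c = -1 \<and> d = 0) \<or> (c = 0 \<and> d = 1) \<or> (c = 0 \<and> d = -1)"
    for c d :: int by auto
  show "stabilizer \<i> = {mat 1, - mat 1, elliptic 0, - elliptic 0}"
    unfolding eq by (auto simp: sol matrix2_eq_iff elliptic_def)
qed

lemma stabilizer_rho:
  defines "\<rho> \<equiv> cis (2 * pi / 3)"
  shows "matrix_subgroup (stabilizer \<rho>)"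
    "stabilizer \<rho> = {mat 1, - mat 1, elliptic 1, - elliptic 1,
        elliptic 1 ** elliptic 1, - (elliptic 1 ** elliptic 1)}"
proof -
  have rho: "\<rho> = Complex (-1/2) (sqrt 3 / 2)"
    by (simp add: \<rho>_def complex_eq_iff cos_120 sin_120)
  have eq: "stabilizer \<rho> = {mat2 (d - c * 1) (- c) c d | c d. c\<^sup>2 - 1 * c * d + d\<^sup>2 = 1}"
    by (rule stabilizer_quadratic) (auto simp: rho complex_eq_iff power2_eq_square)
  show "matrix_subgroup (stabilizer \<rho>)" unfolding eq by (rule matrix_subgroup_quadratic)
  have "(c = 1 \<and> d = 0) \<or> (c = -1 \<and> d = 0) \<or> (c = 0 \<and> d = 1) \<or> (c = 0 \<and> d = -1)
      \<or> (c = 1 \<and> d = 1) \<or> (c = -1 \<and> d = -1)"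
    if "c\<^sup>2 - c * d + d\<^sup>2 = 1" for c d :: int
  proof -
    have "(2 * c - d)\<^sup>2 + 3 * d\<^sup>2 = 4" "(2 * d - c)\<^sup>2 + 3 * c\<^sup>2 = 4"
      using that by (simp_all add: algebra_simps power2_eq_square)
    then have "c\<^sup>2 \<le> 1" "d\<^sup>2 \<le> 1"
      using zero_le_power2[of "2 * c - d"] zero_le_power2[of "2 * d - c"] by linarith+
    then show ?thesis using that square_le_1_int[of c] square_le_1_int[of d] by auto
  qed
  then have sol: "c\<^sup>2 - c * d + d\<^sup>2 = 1 \<longleftrightarrow> (c = 1 \<and> d = 0) \<or> (c = -1 \<and> d = 0) \<or>
      (c = 0 \<and> d = 1) \<or> (c = 0 \<and> d = -1) \<or> (c = 1 \<and> d = 1) \<or> (c = -1 \<and> d = -1)"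
    for c d :: int by auto
  show "stabilizer \<rho> = {mat 1, - mat 1, elliptic 1, - elliptic 1,
        elliptic 1 ** elliptic 1, - (elliptic 1 ** elliptic 1)}"
    unfolding eq by (auto simp: sol matrix2_eq_iff elliptic_def)
qed

lemma mult_uminus_right: "M ** (- B) = - (M ** B)" for M B :: "int^2^2"
  by (simp add: vec_eq_iff forall_2)

lemma right_coset_mult_uminus:
  assumes "M \<in> SL2Z" "B \<in> SL2Z"
  shows "right_coset N (M ** (- B)) = right_coset N (M ** B)"
  using right_coset_uminus[OF SL2Z_mult[OF assms]] by (simp add: mult_uminus_right)

lemma fixed_cosets_subset: "fixed_cosets N s \<subseteq> right_cosets N"
  by (auto simp: fixed_cosets_def right_cosets_def)

lemma finite_right_cosets: "prime p \<Longrightarrow> finite (right_cosets (p ^ Suc k))"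
  by (simp only: right_cosets_prime_power) simp

text \<open>The orbit of $\Gamma_0(N) M$ consists of itself and its image under the involution \<open>elliptic 0\<close>,
  and these are distinct unless the coset is one of the at most two fixed ones. The condition
  \<open>p > 3\<close> makes $p$ prime to the discriminant $-4$.\<close>
lemma card_double_cosets_i:
  assumes p: "prime p" "p > 3"
  shows "card (right_cosets (p ^ Suc k)) \<le> 2 * card (double_cosets (p ^ Suc k) (stabilizer \<i>))"
    and "2 * card (double_cosets (p ^ Suc k) (stabilizer \<i>)) \<le> card (right_cosets (p ^ Suc k)) + 4"
proof -
  let ?N = "p ^ Suc k"
  have fib: "{C \<in> right_cosets ?N. saturate (stabilizer \<i>) C = saturate (stabilizer \<i>) (right_coset ?N M)}
      = {right_coset ?N M, right_coset ?N (M ** elliptic 0)}" if M: "M \<in> SL2Z" for M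
    unfolding saturate_fibre[OF stabilizer_i(1) M]
    by (simp add: stabilizer_i(2) right_coset_mult_uminus[OF M] elliptic_SL2Z mat_1_SL2Z
        insert_commute del: power_Suc)
  have "\<not> int p dvd 4"
  proof
    assume "int p dvd 4"
    then have "p dvd 2 ^ 2" by (metis int_dvd_int_iff of_nat_numeral power2_eq_square numeral_Bit0 mult_2 numeral_times_numeral semiring_norm(13))
    then have "p dvd 2" using p prime_dvd_power by blast
    then show False using p by (auto dest: dvd_imp_le)
  qed
  then have disc: "\<not> int p dvd 0\<^sup>2 - 4" by simp
  have E: "card (fixed_cosets ?N 0) \<le> 2" by (rule card_fixed_cosets[OF p(1) disc])
  note cf = card_image_fibres[OF finite_right_cosets[OF p(1), of k] fixed_cosets_subset[of _ 0],
      of "saturate (stabilizer \<i>)" 2]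
  have le: "card {C' \<in> right_cosets ?N. saturate (stabilizer \<i>) C' = saturate (stabilizer \<i>) C} \<le> 2"
    if C: "C \<in> right_cosets ?N" for C
  proof -
    obtain M where M: "M \<in> SL2Z" "C = right_coset ?N M" using C unfolding right_cosets_def by blast
    show ?thesis unfolding M(2) fib[OF M(1)] by (simp add: card_insert_if del: power_Suc)
  qed
  have eq: "card {C' \<in> right_cosets ?N. saturate (stabilizer \<i>) C' = saturate (stabilizer \<i>) C} = 2"
    if C: "C \<in> right_cosets ?N - fixed_cosets ?N 0" for C
  proof -
    obtain M where M: "M \<in> SL2Z" "C = right_coset ?N M" using C unfolding right_cosets_def by blast
    then have "right_coset ?N (M ** elliptic 0) \<noteq> right_coset ?N M"
      using C unfolding fixed_cosets_def by blast
    then show ?thesis unfolding M(2) fib[OF M(1)] by simp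
  qed
  show "card (right_cosets ?N) \<le> 2 * card (double_cosets ?N (stabilizer \<i>))"
    unfolding double_cosets_eq_saturate using cf(1)[OF le eq] by blast
  show "2 * card (double_cosets ?N (stabilizer \<i>)) \<le> card (right_cosets ?N) + 4"
    unfolding double_cosets_eq_saturate using cf(2)[OF le eq] E by linarith
qed

text \<open>As for $i$, with a generator whose cube is $-1$: the three cosets in an orbit are
  pairwise distinct as soon as the first two are, and the discriminant is $-3$.\<close>
lemma card_double_cosets_rho:
  assumes p: "prime p" "p > 3"
  defines "\<rho> \<equiv> cis (2 * pi / 3)"
  shows "card (right_cosets (p ^ Suc k)) \<le> 3 * card (double_cosets (p ^ Suc k) (stabilizer \<rho>))"
    and "3 * card (double_cosets (p ^ Suc k) (stabilizer \<rho>)) \<le> card (right_cosets (p ^ Suc k)) + 6"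
proof -
  let ?N = "p ^ Suc k"
  let ?e = "elliptic 1"
  have fib: "{C \<in> right_cosets ?N. saturate (stabilizer \<rho>) C = saturate (stabilizer \<rho>) (right_coset ?N M)}
      = {right_coset ?N M, right_coset ?N (M ** ?e), right_coset ?N (M ** (?e ** ?e))}" if M: "M \<in> SL2Z" for M
    unfolding \<rho>_def saturate_fibre[OF stabilizer_rho(1) M]
    by (simp add: stabilizer_rho(2) right_coset_mult_uminus[OF M] elliptic_SL2Z mat_1_SL2Z SL2Z_mult
        insert_commute del: power_Suc)
  have "\<not> int p dvd 3"
    using p by (auto dest: zdvd_imp_le)
  then have disc: "\<not> int p dvd 1\<^sup>2 - 4" by simp
  have E: "card (fixed_cosets ?N 1) \<le> 2" by (rule card_fixed_cosets[OF p(1) disc])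
  note cf = card_image_fibres[OF finite_right_cosets[OF p(1), of k] fixed_cosets_subset[of _ 1],
      of "saturate (stabilizer \<rho>)" 3]
  have le: "card {C' \<in> right_cosets ?N. saturate (stabilizer \<rho>) C' = saturate (stabilizer \<rho>) C} \<le> 3"
    if C: "C \<in> right_cosets ?N" for C
  proof -
    obtain M where M: "M \<in> SL2Z" "C = right_coset ?N M" using C unfolding right_cosets_def by blast
    show ?thesis unfolding M(2) fib[OF M(1)] by (simp add: card_insert_if del: power_Suc)
  qed
  have eq: "card {C' \<in> right_cosets ?N. saturate (stabilizer \<rho>) C' = saturate (stabilizer \<rho>) C} = 3"
    if C: "C \<in> right_cosets ?N - fixed_cosets ?N 1" for C
  proof -
    obtain M where M: "M \<in> SL2Z" "C = right_coset ?N M" using C unfolding right_cosets_def by blast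
    then have ne: "right_coset ?N (M ** ?e) \<noteq> right_coset ?N M"
      using C unfolding fixed_cosets_def by blast
    \<comment> \<open>By $W^2 = W - 1$ the generator $W$ satisfies $W^3 = -1$.\<close>
    have cube: "M ** (?e ** ?e) ** ?e = - M"
      by (simp add: matrix2_eq_iff elliptic_def)
    have ne2: "right_coset ?N (M ** (?e ** ?e)) \<noteq> right_coset ?N M"
    proof
      assume h: "right_coset ?N (M ** (?e ** ?e)) = right_coset ?N M"
      from right_coset_mult_cong[OF h, of ?e] show False
        unfolding cube right_coset_uminus[OF M(1)] by (rule notE[OF ne[symmetric]])
    qed
    have ne3: "right_coset ?N (M ** (?e ** ?e)) \<noteq> right_coset ?N (M ** ?e)"
    proof
      assume h: "right_coset ?N (M ** (?e ** ?e)) = right_coset ?N (M ** ?e)"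
      from right_coset_mult_cong[OF h, of ?e] show False
        unfolding cube right_coset_uminus[OF M(1)] matrix_mul_assoc[of M ?e ?e, symmetric]
        by (rule notE[OF ne2[symmetric]])
    qed
    show ?thesis unfolding M(2) fib[OF M(1)] using ne ne2 ne3 by (simp add: card_insert_if del: power_Suc)
  qed
  show "card (right_cosets ?N) \<le> 3 * card (double_cosets ?N (stabilizer \<rho>))"
    unfolding double_cosets_eq_saturate using cf(1)[OF le eq] by blast
  show "3 * card (double_cosets ?N (stabilizer \<rho>)) \<le> card (right_cosets ?N) + 6"
    unfolding double_cosets_eq_saturate using cf(2)[OF le eq] E by linarith
qed

section \<open>Cusps\<close>

lemma matrix_subgroup_infinity: "matrix_subgroup stabilizer_infinity"
  unfolding matrix_subgroup_def
proof (intro conjI ballI)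
  show "stabilizer_infinity \<subseteq> SL2Z" by (auto simp: stabilizer_infinity_def)
  show "mat 1 \<in> stabilizer_infinity" by (simp add: stabilizer_infinity_def mat_1_SL2Z)
next
  fix B B' assume "B \<in> stabilizer_infinity" "B' \<in> stabilizer_infinity"
  then show "B ** B' \<in> stabilizer_infinity" by (simp add: stabilizer_infinity_def SL2Z_mult)
next
  fix B assume B: "B \<in> stabilizer_infinity"
  let ?B' = "mat2 (B$2$2) (- (B$1$2)) 0 (B$1$1)"
  have "?B' \<in> stabilizer_infinity" "B ** ?B' = mat 1"
    using B by (auto simp: stabilizer_infinity_def SL2Z_iff matrix2_eq_iff algebra_simps)
  then show "\<exists>B'\<in>stabilizer_infinity. B ** B' = mat 1" by blast
qed

text \<open>If $p$ does not divide $t$, the translation by $-b$ with $t b \equiv 1$ moves $(t : 1)$ to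
  $(t : 0) = (1 : 0)$. Hence every orbit contains one of the $p^k$ points $(p t' : 1)$ or one of
  the $p^k$ points $(1 : p u)$.\<close>
lemma card_cusps_le:
  assumes p: "prime p"
  shows "card (double_cosets (p ^ Suc k) stabilizer_infinity) \<le> 2 * p ^ k"
proof -
  let ?N = "p ^ Suc k"
  let ?f = "\<lambda>t. saturate stabilizer_infinity (right_coset ?N (finite_point (int p * t)))"
  let ?i = "\<lambda>u. saturate stabilizer_infinity (right_coset ?N (infinite_point (int p * u)))"
  let ?D = "{0..<int (p ^ k)}"
  have p0: "int p > 0" using p by (simp add: prime_gt_0_nat)
  have "double_cosets ?N stabilizer_infinity \<subseteq> ?f ` ?D \<union> ?i ` ?D"
  proof
    fix X assume "X \<in> double_cosets ?N stabilizer_infinity"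
    then obtain C where C: "C \<in> right_cosets ?N" "X = saturate stabilizer_infinity C"
      by (auto simp: double_cosets_eq_saturate)
    from C(1) consider u where "u \<in> ?D" "C = right_coset ?N (infinite_point (int p * u))"
      | t where "t \<in> {0..<int ?N}" "C = right_coset ?N (finite_point t)"
      unfolding right_cosets_prime_power[OF p] by blast
    then show "X \<in> ?f ` ?D \<union> ?i ` ?D"
    proof cases
      case 1
      then show ?thesis using C by blast
    next
      case 2
      show ?thesis
      proof (cases "int p dvd t")
        case True
        then obtain t' where t': "t = int p * t'" by blast
        have "0 \<le> int p * t'" "int p * t' < int p * int (p ^ k)" using 2(1) t' by simp_all
        then have "t' \<in> ?D" using p0 by (simp add: zero_le_mult_iff)
        then show ?thesis using C 2 t' by blast
      next
        case False
        obtain b where b: "int ?N dvd t * b - 1" using cong_int_inverse[OF p False] by blast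
        have T: "mat2 1 (- b) 0 1 \<in> stabilizer_infinity"
          by (simp add: stabilizer_infinity_def SL2Z_iff)
        have T': "mat2 1 (- b) 0 1 \<in> SL2Z" by (simp add: SL2Z_iff)
        have "right_coset ?N (finite_point t ** mat2 1 (- b) 0 1) = right_coset ?N (infinite_point 0)"
        proof (subst right_coset_eq_iff)
          show "int ?N dvd (finite_point t ** mat2 1 (- b) 0 1) $ 2 $ 1 * infinite_point 0 $ 2 $ 2 -
             (finite_point t ** mat2 1 (- b) 0 1) $ 2 $ 2 * infinite_point 0 $ 2 $ 1"
            using b by (simp add: finite_point_def infinite_point_def)
        qed (simp_all add: SL2Z_mult points_SL2Z T')
        then have "X = ?i 0"
          using saturate_mult[OF matrix_subgroup_infinity T, of ?N "finite_point t"] C 2 by simp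
        moreover have "0 \<in> ?D" using p0 by simp
        ultimately show ?thesis by blast
      qed
    qed
  qed
  then have "card (double_cosets ?N stabilizer_infinity) \<le> card (?f ` ?D \<union> ?i ` ?D)"
    by (intro card_mono) auto
  also have "\<dots> \<le> card (?f ` ?D) + card (?i ` ?D)" by (rule card_Un_le)
  also have "\<dots> \<le> card ?D + card ?D" by (intro add_mono card_image_le) auto
  finally show ?thesis by (simp del: of_nat_power power_Suc)
qed

section \<open>Asymptotics of the genus\<close>

text \<open>With $n = N + p^k$ edges, the Euler characteristic lies between $-n/6$ and
  $-n/6 + 4 + 2 p^k$. The constant $30$ is generous: it also absorbs the difference of $n$ and $N$
  and the rounding in the division by $2$.\<close>
lemma genus_X0_bounds:
  assumes p: "prime p" "p > 3"
  shows "\<bar>12 * genus_X0 (p ^ Suc k) - int (p ^ Suc k)\<bar> \<le> 30 * int (p ^ k)"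
proof -
  let ?N = "p ^ Suc k"
  define n where "n = int (card (right_cosets ?N))"
  define vi where "vi = int (card (double_cosets ?N (stabilizer \<i>)))"
  define vr where "vr = int (card (double_cosets ?N (stabilizer (cis (2 * pi / 3)))))"
  define vc where "vc = int (card (double_cosets ?N stabilizer_infinity))"
  have n: "n = int ?N + int (p ^ k)"
    unfolding n_def card_right_cosets_prime_power[OF p(1)] by simp
  have i: "n \<le> 2 * vi" "2 * vi \<le> n + 4"
    using card_double_cosets_i[OF p, of k] unfolding n_def vi_def by linarith+
  have r: "n \<le> 3 * vr" "3 * vr \<le> n + 6"
    using card_double_cosets_rho[OF p, of k] unfolding n_def vr_def by linarith+
  have c: "0 \<le> vc" "vc \<le> 2 * int (p ^ k)"
    using card_cusps_le[OF p(1), of k] unfolding vc_def by linarith+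
  have e: "euler_char_X0 ?N = vi + vr - n + vc"
    unfolding euler_char_X0_def card_double_cosets_pm1 n_def vi_def vr_def vc_def ..
  have "int (p ^ k) \<ge> 1" using p by simp
  moreover have "2 * genus_X0 ?N \<le> 2 - euler_char_X0 ?N" "2 * genus_X0 ?N \<ge> 1 - euler_char_X0 ?N"
    unfolding genus_X0_def by linarith+
  ultimately show ?thesis using n i r c e by linarith
qed

lemma genus_X0_tendsto:
  "((\<lambda>p. real_of_int (genus_X0 (p ^ 4)) / real p ^ 4) \<longlongrightarrow> 1 / 12)
     (inf at_top (principal primes_5_mod_12))" (is "(?g \<longlongrightarrow> _) ?F")
proof -
  have "eventually (\<lambda>p. norm (?g p - 1 / 12) \<le> (5 / 2) / real p) ?F"
    unfolding eventually_inf_principal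
  proof (rule eventually_mono[OF eventually_gt_at_top[of 3]], rule impI)
    fix p :: nat assume p3: "p > 3" and "p \<in> primes_5_mod_12"
    then have p: "prime p" by (simp add: primes_5_mod_12_def)
    have "\<bar>12 * genus_X0 (p ^ 4) - int (p ^ 4)\<bar> \<le> 30 * int (p ^ 3)"
      using genus_X0_bounds[OF p p3, of 3] by simp
    then have "real_of_int \<bar>12 * genus_X0 (p ^ 4) - int (p ^ 4)\<bar> \<le> real_of_int (30 * int (p ^ 3))"
      by (simp only: of_int_le_iff)
    then have b: "\<bar>12 * real_of_int (genus_X0 (p ^ 4)) - real p ^ 4\<bar> \<le> 30 * real p ^ 3"
      by simp
    have "?g p - 1 / 12 = (12 * real_of_int (genus_X0 (p ^ 4)) - real p ^ 4) / (12 * real p ^ 4)"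
      using p3 by (simp add: field_simps)
    then have "norm (?g p - 1 / 12)
        = \<bar>12 * real_of_int (genus_X0 (p ^ 4)) - real p ^ 4\<bar> / (12 * real p ^ 4)"
      by simp
    also have "\<dots> \<le> 30 * real p ^ 3 / (12 * real p ^ 4)" using b by (intro divide_right_mono) auto
    also have "\<dots> = (5 / 2) / real p" using p3 by (simp add: field_simps power_numeral_reduce)
    finally show "norm (?g p - 1 / 12) \<le> (5 / 2) / real p" .
  qed
  moreover have "((\<lambda>p::nat. (5 / 2) / real p) \<longlongrightarrow> 0) ?F"
    by (rule tendsto_mono[of _ at_top]) (simp, real_asymp)
  ultimately have "((\<lambda>p. ?g p - 1 / 12) \<longlongrightarrow> 0) ?F"
    by (rule Lim_null_comparison)
  then show ?thesis by (rule LIM_zero_cancel)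
qed

section \<open>Asymptotics of the intersection numbers\<close>

text \<open>A power of $p$ that bounds, up to a constant, the multiplicities of both $V_0$ and $V_\infty$.\<close>
definition component_scale :: "nat \<Rightarrow> component \<Rightarrow> real" where
  "component_scale p c = (if c = C40 \<or> c = C04 then 1 else real p)"

text \<open>The leading coefficients of the intersection matrix in the rescaled basis. The entries of $E_1'$
  and $E_3'$ are bounded, so that they vanish after division by $p^2$.\<close>
definition limit_matrix :: "real list list" where
  "limit_matrix =
    [[-1/12,     0,  1/12,     0, 0, 0],
     [    0, -1/12,     0,  1/12, 0, 0],
     [ 1/12,     0,  -1/8,  1/24, 0, 0],
     [    0,  1/12,  1/24,  -1/8, 0, 0],
     [    0,     0,     0,     0, 0, 0],
     [    0,     0,     0,     0, 0, 0]]"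

lemmas of_rat_arith = of_rat_add of_rat_mult of_rat_diff of_rat_minus of_rat_divide of_rat_power

lemma intersection_matrix_tendsto:
  "(\<lambda>p. of_rat (intersection_matrix p ! index c ! index d) * component_scale p c * component_scale p d
      / real p ^ 4) \<longlonglongrightarrow> limit_matrix ! index c ! index d"
  by (cases c; cases d;
      simp add: intersection_matrix_def Let_def of_rat_arith component_scale_def limit_matrix_def;
      real_asymp)

lemma sum_component: "sum f (UNIV :: component set) = f C40 + f C04 + f C31 + f C13 + f E1 + f E3"
proof -
  have *: "(UNIV :: component set) = {C40, C04, C31, C13, E1, E3}"
    using component.exhaust by blast
  show ?thesis unfolding * by (simp add: add.assoc)
qed

text \<open>In the rescaled basis the intersection number divided by $p^4$ is a finite sum of products of
  convergent sequences.\<close>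
lemma intersection_number_tendsto:
  assumes V: "\<And>c. (\<lambda>p. of_rat (V p c) / component_scale p c) \<longlonglongrightarrow> v c"
    and W: "\<And>c. (\<lambda>p. of_rat (W p c) / component_scale p c) \<longlonglongrightarrow> w c"
  shows "(\<lambda>p. of_rat (intersection_number p (V p) (W p)) / real p ^ 4)
    \<longlonglongrightarrow> (\<Sum>c\<in>UNIV. \<Sum>d\<in>UNIV. v c * w d * limit_matrix ! index c ! index d)"
proof (rule Lim_transform_eventually)
  let ?m = "\<lambda>p c d. of_rat (intersection_matrix p ! index c ! index d) * component_scale p c
      * component_scale p d / real p ^ 4"
  show "(\<lambda>p. \<Sum>c\<in>UNIV. \<Sum>d\<in>UNIV. (of_rat (V p c) / component_scale p c)
      * (of_rat (W p d) / component_scale p d) * ?m p c d)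
    \<longlonglongrightarrow> (\<Sum>c\<in>UNIV. \<Sum>d\<in>UNIV. v c * w d * limit_matrix ! index c ! index d)"
    by (intro tendsto_sum tendsto_mult V W intersection_matrix_tendsto)
  have "(\<Sum>c\<in>UNIV. \<Sum>d\<in>UNIV. (of_rat (V p c) / component_scale p c)
      * (of_rat (W p d) / component_scale p d) * ?m p c d)
    = of_rat (intersection_number p (V p) (W p)) / real p ^ 4" if "p > 0" for p
  proof -
    have "component_scale p c \<noteq> 0" for c using that by (simp add: component_scale_def)
    then show ?thesis
      by (simp add: intersection_number_def of_rat_sum of_rat_mult sum_divide_distrib mult.assoc)
  qed
  then show "eventually (\<lambda>p. (\<Sum>c\<in>UNIV. \<Sum>d\<in>UNIV. (of_rat (V p c) / component_scale p c)
      * (of_rat (W p d) / component_scale p d) * ?m p c d)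
    = of_rat (intersection_number p (V p) (W p)) / real p ^ 4) at_top"
    using eventually_gt_at_top[of 0] by (rule eventually_mono[rotated])
qed

definition limit_V_0 :: "component \<Rightarrow> real" where
  "limit_V_0 = (\<lambda>c. case c of C40 \<Rightarrow> 3 | C04 \<Rightarrow> -1 | C31 \<Rightarrow> 2 | C13 \<Rightarrow> 0 | E1 \<Rightarrow> 1 | E3 \<Rightarrow> 0)"

definition limit_V_infinity :: "component \<Rightarrow> real" where
  "limit_V_infinity = (\<lambda>c. case c of C40 \<Rightarrow> 0 | C04 \<Rightarrow> 4 | C31 \<Rightarrow> 1 | C13 \<Rightarrow> 3 | E1 \<Rightarrow> 1/2 | E3 \<Rightarrow> 3/2)"

lemma V_0_tendsto: "(\<lambda>p. of_rat (V_0 p c) / component_scale p c) \<longlonglongrightarrow> limit_V_0 c"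
  by (cases c; simp add: V_0_def limit_V_0_def Let_def of_rat_arith component_scale_def; real_asymp)

lemma V_infinity_tendsto:
  "(\<lambda>p. of_rat (V_infinity p c) / component_scale p c) \<longlonglongrightarrow> limit_V_infinity c"
  by (cases c; simp add: V_infinity_def limit_V_infinity_def Let_def of_rat_arith component_scale_def;
      real_asymp)

lemma intersection_number_0_infinity_tendsto:
  "(\<lambda>p. of_rat (intersection_number p (V_0 p) (V_infinity p)) / real p ^ 4) \<longlonglongrightarrow> 1 / 3"
  using intersection_number_tendsto[OF V_0_tendsto V_infinity_tendsto]
  by (simp add: sum_component limit_matrix_def limit_V_0_def limit_V_infinity_def)

lemma intersection_number_0_0_tendsto:
  "(\<lambda>p. of_rat (intersection_number p (V_0 p) (V_0 p)) / real p ^ 4) \<longlonglongrightarrow> - 1 / 3"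
  using intersection_number_tendsto[OF V_0_tendsto V_0_tendsto]
  by (simp add: sum_component limit_matrix_def limit_V_0_def)

lemma intersection_number_infinity_infinity_tendsto:
  "(\<lambda>p. of_rat (intersection_number p (V_infinity p) (V_infinity p)) / real p ^ 4) \<longlonglongrightarrow> - 1 / 3"
  using intersection_number_tendsto[OF V_infinity_tendsto V_infinity_tendsto]
  by (simp add: sum_component limit_matrix_def limit_V_infinity_def)

theorem proposition4p14:
  defines "g \<equiv> (\<lambda>p::nat. real_of_int (genus_X0 (p ^ 4)))"
  shows "(\<lambda>p. 1 / (g p - 1) *
              (g p * arakelov_pairing p (V_0 p) (V_infinity p)
               - (arakelov_pairing p (V_0 p) (V_0 p)
                  + arakelov_pairing p (V_infinity p) (V_infinity p)) / 2)
            - 4 * g p * ln (real p))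
         \<in> o[inf at_top (principal primes_5_mod_12)](\<lambda>p. g p * ln (real p))"
    (is "?E \<in> o[?F](_)")
proof -
  define I where "I p = real_of_rat (intersection_number p (V_0 p) (V_infinity p))" for p
  define J where "J p = real_of_rat (intersection_number p (V_0 p) (V_0 p))
      + real_of_rat (intersection_number p (V_infinity p) (V_infinity p))" for p
  define h where "h p = g p / real p ^ 4" for p
  define u where "u p = 1 / real p ^ 4" for p :: nat
  \<comment> \<open>The left-hand side divided by $g \log p$, with $p^4$ cancelled from each quotient.\<close>
  define c where "c p = (I p / real p ^ 4) / (h p - u p)
      - (J p / real p ^ 4) / (h p - u p) / h p * u p / 2 - 4" for p
  have le: "?F \<le> at_top" by simp
  have h: "(h \<longlongrightarrow> 1 / 12) ?F"
    using genus_X0_tendsto unfolding h_def g_def .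
  have u: "(u \<longlongrightarrow> 0) ?F"
    unfolding u_def by (rule tendsto_mono[OF le]) real_asymp
  have I: "((\<lambda>p. I p / real p ^ 4) \<longlongrightarrow> 1 / 3) ?F"
    unfolding I_def by (rule tendsto_mono[OF le intersection_number_0_infinity_tendsto])
  have J: "((\<lambda>p. J p / real p ^ 4) \<longlongrightarrow> - 1 / 3 + - 1 / 3) ?F"
    unfolding J_def add_divide_distrib
    by (intro tendsto_add tendsto_mono[OF le intersection_number_0_0_tendsto]
        tendsto_mono[OF le intersection_number_infinity_infinity_tendsto])
  have "(c \<longlongrightarrow> (1 / 3) / (1 / 12 - 0) - (- 1 / 3 + - 1 / 3) / (1 / 12 - 0) / (1 / 12) * 0 / 2 - 4) ?F"
    unfolding c_def by (intro tendsto_intros I J h u) auto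
  then have c: "(c \<longlongrightarrow> 0) ?F" by simp
  have "eventually (\<lambda>p. h p > 1 / 13) ?F"
    using h by (rule order_tendstoD) simp
  moreover have "eventually (\<lambda>p. p > 1) ?F"
    by (rule filter_leD[OF le]) (rule eventually_gt_at_top)
  \<comment> \<open>The constant $13$ serves since $1/13 < 1/12$ and $2^4/13 > 1$.\<close>
  ultimately have ev: "eventually (\<lambda>p. p > 1 \<and> g p > 1) ?F"
  proof eventually_elim
    case (elim p)
    have "real p ^ 4 \<ge> 2 ^ 4" using elim by (intro power_mono) auto
    moreover have "g p > real p ^ 4 / 13" using elim by (simp add: h_def field_simps)
    ultimately show ?case using elim by simp
  qed
  show ?thesis
  proof (rule smalloI_tendsto)
    show "eventually (\<lambda>p. g p * ln (real p) \<noteq> 0) ?F"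
      using ev by eventually_elim auto
    have "eventually (\<lambda>p. c p = ?E p / (g p * ln (real p))) ?F"
      using ev
    proof eventually_elim
      case (elim p)
      then have nz: "g p \<noteq> 0" "g p - 1 \<noteq> 0" "ln (real p) \<noteq> 0" "real p ^ 4 \<noteq> 0" by auto
      have "h p - u p = (g p - 1) / real p ^ 4" by (simp add: h_def u_def diff_divide_distrib)
      then have "c p = I p / (g p - 1) - J p / (g p - 1) / g p / 2 - 4"
        using nz unfolding c_def by (simp add: h_def u_def)
      also have "\<dots> = ?E p / (g p * ln (real p))"
        using nz unfolding arakelov_pairing_def I_def[symmetric] distrib_right[symmetric] J_def[symmetric]
        by (simp add: divide_simps) (simp add: algebra_simps)
      finally show ?case .
    qed
    with c show "((\<lambda>p. ?E p / (g p * ln (real p))) \<longlongrightarrow> 0) ?F"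
      by (rule Lim_transform_eventually)
  qed
qed

end
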